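(* The chordal cubic threefold $X\subset\mathbb{P}^4_{x_1,\dots,x_5}$ over $\mathbb{R}$ given by $$x_1^2x_2+x_1x_2^2+x_2x_3^2+x_1x_4^2-2x_3x_4x_5-(x_1+x_2)x_5^2=0$$ is rational over $\mathbb{R}$.
   Context: Over $\mathbb{C}$, a chordal cubic is the secant variety of a rational normal quartic curve $C\subset\mathbb{P}^4$; it is singular along $C$. The displayed cubic is the real form with $C(\mathbb{R})=\emptyset$. *)

theory Defs
  imports Complex_Main "HOL-Library.Poly_Mapping" "HOL-Algebra.Ideal"
begin

text \<open>
  Projective varieties over a field k are treated as integral closed subschemes of projective
  space over k itself, i.e. through homogeneous prime ideals with coefficients in k. In particular
  nothing refers to the set of k-rational points, and every rational map below is defined over k.

  A polynomial in variables indexed by \<^typ>\<open>nat\<close> is a finitely supported map from exponent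
  vectors to coefficients, with the ring operations of \<^theory>\<open>HOL-Library.Poly_Mapping\<close>.
\<close>

type_synonym 'k mpoly = "(nat \<Rightarrow>\<^sub>0 nat) \<Rightarrow>\<^sub>0 'k"

definition Const :: "'k::field \<Rightarrow> 'k mpoly" where
  "Const c = Poly_Mapping.single 0 c"

definition Var :: "nat \<Rightarrow> 'k::field mpoly" where
  "Var i = Poly_Mapping.single (Poly_Mapping.single i 1) 1"

definition vars :: "'k::field mpoly \<Rightarrow> nat set" where
  "vars p = (\<Union>m\<in>Poly_Mapping.keys p. Poly_Mapping.keys m)"

definition monom_degree :: "(nat \<Rightarrow>\<^sub>0 nat) \<Rightarrow> nat" where
  "monom_degree m = (\<Sum>i\<in>Poly_Mapping.keys m. Poly_Mapping.lookup m i)"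

definition subst :: "(nat \<Rightarrow> 'k::field mpoly) \<Rightarrow> 'k mpoly \<Rightarrow> 'k mpoly" where
  "subst f p = (\<Sum>m\<in>Poly_Mapping.keys p. Const (Poly_Mapping.lookup p m) *
     (\<Prod>i\<in>Poly_Mapping.keys m. f i ^ Poly_Mapping.lookup m i))"

text \<open>
  The homogeneous coordinates of n-dimensional projective space are numbered from 1 to n + 1.
\<close>

abbreviation coord_idx :: "nat \<Rightarrow> nat set" where
  "coord_idx n \<equiv> {1..n + 1}"

definition coord_ring :: "nat \<Rightarrow> 'k::field mpoly ring" where
  "coord_ring n = \<lparr>carrier = {p. vars p \<subseteq> coord_idx n},
     monoid.mult = (*), one = 1, zero = 0, add = (+)\<rparr>"

text \<open>As usual, \<open>forms n d\<close> contains the zero polynomial for every d.\<close>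

definition forms :: "nat \<Rightarrow> nat \<Rightarrow> 'k::field mpoly set" where
  "forms n d = {p \<in> carrier (coord_ring n). \<forall>m\<in>Poly_Mapping.keys p. monom_degree m = d}"

definition homogeneous_ideal :: "nat \<Rightarrow> 'k::field mpoly set \<Rightarrow> bool" where
  "homogeneous_ideal n I \<longleftrightarrow> (\<exists>S \<subseteq> (\<Union>d. forms n d). I = Idl\<^bsub>coord_ring n\<^esub> S)"

text \<open>
  The last condition excludes the irrelevant ideal, which defines the empty subscheme.
\<close>

definition proj_variety :: "nat \<Rightarrow> 'k::field mpoly set \<Rightarrow> bool" where
  "proj_variety n I \<longleftrightarrow> homogeneous_ideal n I \<and> primeideal I (coord_ring n) \<and>
     (\<exists>i\<in>coord_idx n. Var i \<notin> I)"

text \<open>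
  Let X be the variety of the ideal \<open>I\<close> in projective n-space. A rational map from X to
  projective m-space is represented by m + 1 forms of one common degree that do not all vanish
  identically on X. Two tuples represent the same rational map iff the 2-by-2 minors of the
  matrix formed by them vanish on X.
\<close>

definition rat_map :: "nat \<Rightarrow> 'k::field mpoly set \<Rightarrow> nat \<Rightarrow> (nat \<Rightarrow> 'k mpoly) \<Rightarrow> bool" where
  "rat_map n I m \<phi> \<longleftrightarrow> (\<exists>d. \<forall>j\<in>coord_idx m. \<phi> j \<in> forms n d) \<and> (\<exists>j\<in>coord_idx m. \<phi> j \<notin> I)"

definition same_rat_map ::
    "'k::field mpoly set \<Rightarrow> nat \<Rightarrow> (nat \<Rightarrow> 'k mpoly) \<Rightarrow> (nat \<Rightarrow> 'k mpoly) \<Rightarrow> bool" where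
  "same_rat_map I m \<phi> \<psi> \<longleftrightarrow>
     (\<forall>i\<in>coord_idx m. \<forall>j\<in>coord_idx m. \<phi> i * \<psi> j - \<phi> j * \<psi> i \<in> I)"

definition rat_map_into ::
    "nat \<Rightarrow> 'k::field mpoly set \<Rightarrow> nat \<Rightarrow> 'k mpoly set \<Rightarrow> (nat \<Rightarrow> 'k mpoly) \<Rightarrow> bool" where
  "rat_map_into n I m J \<phi> \<longleftrightarrow> rat_map n I m \<phi> \<and> (\<forall>g\<in>J. subst \<phi> g \<in> I)"

definition comp_tuple :: "(nat \<Rightarrow> 'k::field mpoly) \<Rightarrow> (nat \<Rightarrow> 'k mpoly) \<Rightarrow> nat \<Rightarrow> 'k mpoly" where
  "comp_tuple \<psi> \<phi> j = subst \<phi> (\<psi> j)"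

text \<open>
  In \<open>mutually_inverse\<close>, the two \<^const>\<open>rat_map\<close> conditions on the composites say that these are
  defined as rational maps; the tuple \<^const>\<open>Var\<close> represents the identity. Dominance of both maps
  is a consequence.
\<close>

definition mutually_inverse ::
    "nat \<Rightarrow> 'k::field mpoly set \<Rightarrow> nat \<Rightarrow> 'k mpoly set \<Rightarrow>
     (nat \<Rightarrow> 'k mpoly) \<Rightarrow> (nat \<Rightarrow> 'k mpoly) \<Rightarrow> bool" where
  "mutually_inverse n I m J \<phi> \<psi> \<longleftrightarrow>
     rat_map n I n (comp_tuple \<psi> \<phi>) \<and> same_rat_map I n (comp_tuple \<psi> \<phi>) Var \<and>
     rat_map m J m (comp_tuple \<phi> \<psi>) \<and> same_rat_map J m (comp_tuple \<phi> \<psi>) Var"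

definition birational :: "nat \<Rightarrow> 'k::field mpoly set \<Rightarrow> nat \<Rightarrow> 'k mpoly set \<Rightarrow> bool" where
  "birational n I m J \<longleftrightarrow> proj_variety n I \<and> proj_variety m J \<and>
     (\<exists>\<phi> \<psi>. rat_map_into n I m J \<phi> \<and> rat_map_into m J n I \<psi> \<and> mutually_inverse n I m J \<phi> \<psi>)"

text \<open>
  \<open>rational_variety d n I\<close>: the variety of \<open>I\<close> in projective n-space over the coefficient field
  is birational, over that field, to projective d-space (so d is its dimension).
\<close>

definition rational_variety :: "nat \<Rightarrow> nat \<Rightarrow> 'k::field mpoly set \<Rightarrow> bool" where
  "rational_variety d n I \<longleftrightarrow> birational n I d {0}"

text \<open>
  The form below is minus the determinant of the generic traceless symmetric matrix
  with rows (x1, x5, x3), (x5, x2, x4), (x3, x4, -x1-x2).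
\<close>

definition chordal_cubic_form :: "real mpoly" where
  "chordal_cubic_form =
     Var 1 ^ 2 * Var 2 + Var 1 * Var 2 ^ 2 + Var 2 * Var 3 ^ 2 + Var 1 * Var 4 ^ 2
     - 2 * Var 3 * Var 4 * Var 5 - (Var 1 + Var 2) * Var 5 ^ 2"

definition chordal_cubic :: "real mpoly set" where
  "chordal_cubic = Idl\<^bsub>coord_ring 4\<^esub> {chordal_cubic_form}"

end

theory Submission
  imports Defs "HOL-Computational_Algebra.Polynomial"
begin

text \<open>
  The cubic X parametrises the traceless symmetric 3-by-3 matrices M with determinant 0. Sending M to
  its kernel is a rational map from X to the projective plane, and its fibres are cut out by linear
  equations: for a kernel vector (s, t, 1) the entries satisfy
  x3 = -(s x1 + t x5), x4 = -(s x5 + t x2) and (1 + s^2) x1 + 2 s t x5 + (1 + t^2) x2 = 0,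
  so a matrix in the fibre is determined up to scaling by u = x5 / x1. Thus (s, t, u) are birational
  coordinates on X, defined over the reals.

  It remains to see that the cubic form F generates a prime ideal. Its zeros with 0 < x1 < 1 and
  x2 < -1 lie in the image of the cone over the parametrisation, so it suffices that a polynomial p vanishing
  there is a multiple of F; then the ideal is the kernel of a substitution into a polynomial ring.
  Division by F with respect to x3 gives x2^N p = q F + a x3 + b. In the given region F has
  two distinct real roots in x3, so a and b vanish on an open set and hence are 0; finally x2 is a
  nonzerodivisor modulo F.
\<close>

section \<open>Evaluation and substitution\<close>

text \<open>One notion serves two purposes: \<open>c = Const\<close> gives substitution of
  polynomials, and the identity gives values at points over the coefficient field.\<close>

definition peval :: "('k \<Rightarrow> 'a) \<Rightarrow> (nat \<Rightarrow> 'a) \<Rightarrow> 'k::field mpoly \<Rightarrow> 'a::comm_ring_1" where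
  "peval c f p = (\<Sum>m\<in>Poly_Mapping.keys p. c (Poly_Mapping.lookup p m) *
     (\<Prod>i\<in>Poly_Mapping.keys m. f i ^ Poly_Mapping.lookup m i))"

lemma subst_eq_peval: "subst = peval Const"
  by (simp add: subst_def peval_def fun_eq_iff)

lemma sum_singles: "(\<Sum>m\<in>Poly_Mapping.keys p. Poly_Mapping.single m (Poly_Mapping.lookup p m)) = p"
  by (rule poly_mapping_eqI) (auto simp: lookup_sum lookup_single when_def in_keys_iff)

lemma prod_keys_superset:
  fixes f :: "nat \<Rightarrow> 'a::comm_monoid_mult"
  assumes "finite A" "Poly_Mapping.keys m \<subseteq> A"
  shows "(\<Prod>i\<in>Poly_Mapping.keys m. f i ^ Poly_Mapping.lookup m i) = (\<Prod>i\<in>A. f i ^ Poly_Mapping.lookup m i)"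
  using assms by (intro prod.mono_neutral_left) (auto simp: in_keys_iff)

lemma prod_keys_add:
  fixes f :: "nat \<Rightarrow> 'a::comm_monoid_mult"
  shows "(\<Prod>i\<in>Poly_Mapping.keys (m + m'). f i ^ Poly_Mapping.lookup (m + m') i) =
    (\<Prod>i\<in>Poly_Mapping.keys m. f i ^ Poly_Mapping.lookup m i) *
    (\<Prod>i\<in>Poly_Mapping.keys m'. f i ^ Poly_Mapping.lookup m' i)"
proof -
  let ?A = "Poly_Mapping.keys m \<union> Poly_Mapping.keys m'"
  have "Poly_Mapping.keys (m + m') \<subseteq> ?A" by (rule keys_add)
  then show ?thesis
    using prod_keys_superset[of ?A "m + m'" f] prod_keys_superset[of ?A m f] prod_keys_superset[of ?A m' f]
    unfolding lookup_add power_add prod.distrib by simp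
qed

text \<open>
  The first two assumptions are not simplification rules, since for the identity they read
  0 = 0 and 1 = 1 and make the simplifier loop.
\<close>

locale coeff_hom =
  fixes c :: "'k::field \<Rightarrow> 'a::comm_ring_1"
  assumes hom_0: "c 0 = 0" and hom_1: "c 1 = 1"
    and hom_add: "c (x + y) = c x + c y" and hom_mult: "c (x * y) = c x * c y"
begin

lemma peval_superset:
  assumes "finite A" "Poly_Mapping.keys p \<subseteq> A"
  shows "peval c f p = (\<Sum>m\<in>A. c (Poly_Mapping.lookup p m) *
     (\<Prod>i\<in>Poly_Mapping.keys m. f i ^ Poly_Mapping.lookup m i))"
  unfolding peval_def using assms by (intro sum.mono_neutral_left) (auto simp: in_keys_iff hom_0)

lemma peval_0 [simp]: "peval c f 0 = 0"
  by (simp add: peval_def)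

lemma peval_add [simp]: "peval c f (p + q) = peval c f p + peval c f q"
proof -
  let ?A = "Poly_Mapping.keys p \<union> Poly_Mapping.keys q"
  have "Poly_Mapping.keys (p + q) \<subseteq> ?A" by (rule keys_add)
  then show ?thesis
    by (simp add: peval_superset[of ?A] lookup_add hom_add algebra_simps sum.distrib)
qed

lemma peval_sum: "peval c f (sum g A) = (\<Sum>a\<in>A. peval c f (g a))"
  by (induction A rule: infinite_finite_induct) auto

lemma peval_single:
  "peval c f (Poly_Mapping.single m a) = c a * (\<Prod>i\<in>Poly_Mapping.keys m. f i ^ Poly_Mapping.lookup m i)"
  by (cases "a = 0") (simp_all add: peval_def hom_0)

lemma peval_mult [simp]: "peval c f (p * q) = peval c f p * peval c f q"
proof -
  have "p * q = (\<Sum>m\<in>Poly_Mapping.keys p. \<Sum>m'\<in>Poly_Mapping.keys q.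
      Poly_Mapping.single (m + m') (Poly_Mapping.lookup p m * Poly_Mapping.lookup q m'))"
    by (subst sum_singles[of p, symmetric], subst sum_singles[of q, symmetric])
       (simp only: sum_product mult_single)
  then have "peval c f (p * q) = (\<Sum>m\<in>Poly_Mapping.keys p. \<Sum>m'\<in>Poly_Mapping.keys q.
      peval c f (Poly_Mapping.single (m + m') (Poly_Mapping.lookup p m * Poly_Mapping.lookup q m')))"
    by (simp only: peval_sum)
  also have "\<dots> = peval c f p * peval c f q"
    unfolding peval_single peval_def[of c f p] peval_def[of c f q] sum_product prod_keys_add hom_mult
    by (simp only: mult_ac)
  finally show ?thesis .
qed

lemma peval_Const [simp]: "peval c f (Const a) = c a"
  by (simp add: Const_def peval_single)

lemma peval_Var [simp]: "peval c f (Var i) = f i"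
  by (simp add: Var_def peval_single hom_1)

lemma peval_1 [simp]: "peval c f 1 = 1"
  using peval_Const[of f 1] by (simp add: Const_def hom_1)

lemma peval_minus [simp]: "peval c f (- p) = - peval c f p"
  using peval_add[of f p "- p"] by (simp add: eq_neg_iff_add_eq_0 add.commute)

lemma peval_diff [simp]: "peval c f (p - q) = peval c f p - peval c f q"
  using peval_add[of f p "- q"] by simp

lemma peval_power [simp]: "peval c f (p ^ n) = peval c f p ^ n"
  by (induction n) auto

lemma peval_of_nat [simp]: "peval c f (of_nat n) = of_nat n"
  by (induction n) auto

lemma peval_numeral [simp]: "peval c f (numeral n) = numeral n"
  using peval_of_nat[of f "numeral n"] by simp

end

lemma Const_simps:
  "Const 0 = 0" "Const 1 = 1" "Const (a + b) = Const a + Const b" "Const (a * b) = Const a * Const b"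
  by (simp_all add: Const_def single_add mult_single)

interpretation subst: coeff_hom "Const :: 'k::field \<Rightarrow> 'k mpoly"
  rewrites "peval Const = subst"
  by unfold_locales (simp_all add: Const_simps subst_eq_peval)

abbreviation eval :: "(nat \<Rightarrow> 'k) \<Rightarrow> 'k::field mpoly \<Rightarrow> 'k" where
  "eval \<equiv> peval (\<lambda>x. x)"

interpretation eval: coeff_hom "\<lambda>x::'k::field. x"
  by unfold_locales simp_all

lemma peval_cong: "(\<And>i. i \<in> vars p \<Longrightarrow> f i = g i) \<Longrightarrow> peval c f p = peval c g p"
  unfolding peval_def
proof (rule sum.cong[OF refl])
  fix m assume *: "\<And>i. i \<in> vars p \<Longrightarrow> f i = g i" and "m \<in> Poly_Mapping.keys p"
  then have "f i = g i" if "i \<in> Poly_Mapping.keys m" for i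
    using that by (auto simp: vars_def)
  then show "c (Poly_Mapping.lookup p m) * (\<Prod>i\<in>Poly_Mapping.keys m. f i ^ Poly_Mapping.lookup m i) =
      c (Poly_Mapping.lookup p m) * (\<Prod>i\<in>Poly_Mapping.keys m. g i ^ Poly_Mapping.lookup m i)"
    by simp
qed

lemma subst_cong: "(\<And>i. i \<in> vars p \<Longrightarrow> f i = g i) \<Longrightarrow> subst f p = subst g p"
  unfolding subst_eq_peval by (rule peval_cong)

section \<open>Monomials and induction over polynomials\<close>

lemma Var_power: "(Var i :: 'k::field mpoly) ^ n = Poly_Mapping.single (Poly_Mapping.single i n) 1"
proof (induction n)
  case 0
  show ?case by (simp only: power_0 single_zero single_one)
next
  case (Suc n)
  have "(Var i :: 'k mpoly) ^ Suc n = Poly_Mapping.single (Poly_Mapping.single i 1 + Poly_Mapping.single i n) (1 * 1)"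
    unfolding power_Suc Suc by (simp only: Var_def mult_single)
  also have "Poly_Mapping.single i 1 + Poly_Mapping.single i n = Poly_Mapping.single i (1 + n)"
    by (rule single_add[symmetric])
  finally show ?case by (simp only: plus_1_eq_Suc mult_1_left)
qed

lemma prod_single:
  "(\<Prod>i\<in>A. Poly_Mapping.single (g i) 1) = (Poly_Mapping.single (\<Sum>i\<in>A. g i) 1 :: 'k::field mpoly)"
  by (induction A rule: infinite_finite_induct) (simp_all add: mult_single)

lemma single_eq_prod:
  "Poly_Mapping.single m a = Const a * (\<Prod>i\<in>Poly_Mapping.keys m. Var i ^ Poly_Mapping.lookup m i)"
  by (simp add: Var_power prod_single sum_singles Const_def mult_single)

lemma subst_Var [simp]: "subst Var p = p"
  using sum_singles[of p] by (simp add: subst_def single_eq_prod)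

text \<open>Every monomial arises from a constant by multiplying with one variable at a time. This
  suits both identities between homomorphisms and the stepwise reduction in
  \<open>pseudo_division\<close>.\<close>

lemma mpoly_induct [case_names Const add Var]:
  assumes c: "\<And>c. P (Const c)" and a: "\<And>p q. P p \<Longrightarrow> P q \<Longrightarrow> P (p + q)"
    and v: "\<And>p i. P p \<Longrightarrow> P (p * Var i)"
  shows "P (p :: 'k::field mpoly)"
proof -
  have pow: "P (q * Var i ^ n)" if "P q" for q i n
  proof (induction n)
    case (Suc n)
    show ?case using v[OF Suc, of i] by (simp only: power_Suc2 mult.assoc)
  qed (simp add: that)
  have prd: "P (Const c * (\<Prod>i\<in>A. Var i ^ e i))" if "finite A" for c A e
    using that
  proof (induction A)
    case (insert x A)
    show ?case using pow[OF insert.IH, of x "e x"] insert.hyps by (simp only: prod.insert mult_ac simp_thms)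
  qed (simp add: c)
  have "P (\<Sum>m\<in>A. Poly_Mapping.single m (Poly_Mapping.lookup p m))" if "finite A" for A
    using that
  proof (induction A)
    case empty
    then show ?case using c[of 0] by (simp add: Const_simps)
  next
    case (insert x A)
    then show ?case using prd a by (simp add: single_eq_prod)
  qed
  then show ?thesis using sum_singles[of p] by (metis finite_keys)
qed

lemma eval_subst: "eval v (subst f p) = eval (\<lambda>i. eval v (f i)) p"
  by (induction p rule: mpoly_induct) auto

section \<open>Variables occurring in a polynomial\<close>

lemma vars_Const [simp]: "vars (Const c) = {}"
  by (auto simp: vars_def Const_def split: if_splits)

lemma vars_0 [simp]: "vars 0 = {}" and vars_1 [simp]: "vars 1 = {}"
  using vars_Const[of 0] vars_Const[of 1] by (simp_all add: Const_simps)

lemma vars_numeral [simp]: "vars (numeral n) = {}"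
  by (simp add: vars_def single_numeral[symmetric] del: single_numeral)

lemma vars_Var [simp]: "vars (Var i) = {i}"
  by (auto simp: vars_def Var_def)

lemma vars_add: "vars (p + q) \<subseteq> vars p \<union> vars q"
  using keys_add[of p q] by (auto simp: vars_def)

lemma vars_minus [simp]: "vars (- p) = vars p"
  by (simp add: vars_def in_keys_iff Poly_Mapping.keys.rep_eq)

lemma vars_diff: "vars (p - q) \<subseteq> vars p \<union> vars q"
  using vars_add[of p "- q"] by simp

lemma vars_mult: "vars (p * q) \<subseteq> vars p \<union> vars q"
proof
  fix i assume "i \<in> vars (p * q)"
  then obtain m where m: "m \<in> Poly_Mapping.keys (p * q)" "i \<in> Poly_Mapping.keys m"
    by (auto simp: vars_def)
  then obtain a b where "m = a + b" "a \<in> Poly_Mapping.keys p" "b \<in> Poly_Mapping.keys q"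
    using keys_mult[of p q] by blast
  then show "i \<in> vars p \<union> vars q"
    using m(2) keys_add[of a b] by (auto simp: vars_def)
qed

lemma vars_power: "vars (p ^ n) \<subseteq> vars p"
proof (induction n)
  case (Suc n)
  then show ?case using vars_mult[of p "p ^ n"] by auto
qed simp

lemma vars_sum: "vars (sum f A) \<subseteq> (\<Union>a\<in>A. vars (f a))"
proof (induction A rule: infinite_finite_induct)
  case (insert x A)
  then show ?case using vars_add[of "f x" "sum f A"] by auto
qed auto

lemma vars_prod: "vars (prod f A) \<subseteq> (\<Union>a\<in>A. vars (f a))"
proof (induction A rule: infinite_finite_induct)
  case (insert x A)
  then show ?case using vars_mult[of "f x" "prod f A"] by auto
qed auto

lemma vars_subst: "vars (subst f p) \<subseteq> (\<Union>i. vars (f i))"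
proof (induction p rule: mpoly_induct)
  case (add p q)
  then show ?case using vars_add[of "subst f p" "subst f q"] by auto
next
  case (Var p i)
  then show ?case using vars_mult[of "subst f p" "f i"] by auto
qed simp

lemma finite_vars [simp]: "finite (vars p)"
  by (simp add: vars_def)

lemma notin_vars_intros:
  "i \<notin> vars p \<Longrightarrow> i \<notin> vars q \<Longrightarrow> i \<notin> vars (p + q)"
  "i \<notin> vars p \<Longrightarrow> i \<notin> vars q \<Longrightarrow> i \<notin> vars (p - q)"
  "i \<notin> vars p \<Longrightarrow> i \<notin> vars q \<Longrightarrow> i \<notin> vars (p * q)"
  "i \<notin> vars p \<Longrightarrow> i \<notin> vars (p ^ n)"
  using vars_add[of p q] vars_diff[of p q] vars_mult[of p q] vars_power[of p n] by auto

text \<open>Monomials are collected by their exponent at \<open>i\<close>, and the remaining factors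
  go into the coefficients. This makes root counting in one variable available.\<close>

lemma as_univariate:
  fixes p :: "'k::field mpoly"
  obtains P where "p = poly P (Var i)" "\<And>k. vars (coeff P k) \<subseteq> vars p - {i}"
proof
  define t where "t m = Const (Poly_Mapping.lookup p m) *
     (\<Prod>j\<in>Poly_Mapping.keys m - {i}. Var j ^ Poly_Mapping.lookup m j)" for m
  define P where "P = (\<Sum>m\<in>Poly_Mapping.keys p. monom (t m) (Poly_Mapping.lookup m i))"
  have "p = (\<Sum>m\<in>Poly_Mapping.keys p. Poly_Mapping.single m (Poly_Mapping.lookup p m))"
    by (simp only: sum_singles)
  also have "\<dots> = (\<Sum>m\<in>Poly_Mapping.keys p. t m * Var i ^ Poly_Mapping.lookup m i)"
  proof (rule sum.cong[OF refl])
    fix m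
    let ?e = "\<lambda>j. Var j ^ Poly_Mapping.lookup m j :: 'k mpoly"
    have "prod ?e (Poly_Mapping.keys m) = prod ?e (insert i (Poly_Mapping.keys m))"
      by (rule prod_keys_superset) auto
    also have "\<dots> = ?e i * prod ?e (Poly_Mapping.keys m - {i})"
      by (simp add: prod.insert_remove)
    finally show "Poly_Mapping.single m (Poly_Mapping.lookup p m) = t m * Var i ^ Poly_Mapping.lookup m i"
      by (simp add: single_eq_prod t_def mult_ac)
  qed
  also have "\<dots> = poly P (Var i)"
    by (simp add: P_def poly_sum poly_monom)
  finally show "p = poly P (Var i)" .
  have t: "vars (t m) \<subseteq> vars p - {i}" if m: "m \<in> Poly_Mapping.keys p" for m
  proof -
    let ?R = "\<Prod>j\<in>Poly_Mapping.keys m - {i}. Var j ^ Poly_Mapping.lookup m j :: 'k mpoly"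
    have "vars (t m) \<subseteq> vars ?R"
      unfolding t_def using vars_mult[of "Const (Poly_Mapping.lookup p m)" ?R] by (simp only: vars_Const Un_empty_left)
    also have "\<dots> \<subseteq> (\<Union>j\<in>Poly_Mapping.keys m - {i}. vars (Var j ^ Poly_Mapping.lookup m j :: 'k mpoly))"
      by (rule vars_prod)
    also have "\<dots> \<subseteq> Poly_Mapping.keys m - {i}"
    proof (rule UN_least)
      fix j assume "j \<in> Poly_Mapping.keys m - {i}"
      then show "vars (Var j ^ Poly_Mapping.lookup m j :: 'k mpoly) \<subseteq> Poly_Mapping.keys m - {i}"
        using vars_power[of "Var j :: 'k mpoly" "Poly_Mapping.lookup m j"] by auto
    qed
    also have "\<dots> \<subseteq> vars p - {i}"
      using m by (auto simp: vars_def)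
    finally show ?thesis .
  qed
  show "vars (coeff P k) \<subseteq> vars p - {i}" for k
  proof -
    have "vars (coeff P k) \<subseteq> (\<Union>m\<in>Poly_Mapping.keys p. vars (coeff (monom (t m) (Poly_Mapping.lookup m i)) k))"
      unfolding P_def coeff_sum by (rule vars_sum)
    also have "\<dots> \<subseteq> vars p - {i}"
    proof (rule UN_least)
      fix m assume "m \<in> Poly_Mapping.keys p"
      then show "vars (coeff (monom (t m) (Poly_Mapping.lookup m i)) k) \<subseteq> vars p - {i}"
        using t[of m] by (cases "Poly_Mapping.lookup m i = k") simp_all
    qed
    finally show ?thesis .
  qed
qed

lemma eval_poly: "eval v (poly P q) = poly (map_poly (eval v) P) (eval v q)"
  by (induction P) (simp_all add: map_poly_pCons)

lemma no_vars_eq_Const: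
  assumes "vars p = {}"
  shows "p = Const (Poly_Mapping.lookup p 0)"
proof (rule poly_mapping_eqI)
  fix m
  show "Poly_Mapping.lookup p m = Poly_Mapping.lookup (Const (Poly_Mapping.lookup p 0)) m"
  proof (cases "m = 0")
    case False
    then have "m \<notin> Poly_Mapping.keys p" using assms by (auto simp: vars_def)
    with False show ?thesis by (simp add: Const_def lookup_single in_keys_iff)
  qed (simp add: Const_def)
qed

text \<open>Induction on the set of variables: with the other variables fixed in the box, a
  univariate polynomial with infinitely many roots remains. So its coefficients vanish on the box,
  and they involve one variable less.\<close>

lemma mpoly_eq_0_on_box:
  fixes p :: "'k::field mpoly"
  assumes inf: "\<And>i. infinite (S i)" and "\<And>v. (\<And>i. v i \<in> S i) \<Longrightarrow> eval v p = 0"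
  shows "p = 0"
proof -
  have "q = 0" if "finite A" "vars q \<subseteq> A" "\<And>v. (\<And>i. v i \<in> S i) \<Longrightarrow> eval v q = 0" for A q
    using that
  proof (induction A arbitrary: q)
    case empty
    obtain v where "\<And>i. v i \<in> S i"
      using inf that[of "\<lambda>i. SOME x. x \<in> S i"] by (metis finite.emptyI some_in_eq)
    then have "eval v q = 0" by (rule empty)
    moreover have "q = Const (Poly_Mapping.lookup q 0)"
      using empty by (intro no_vars_eq_Const) auto
    ultimately show ?case by (metis Const_simps(1) eval.peval_Const)
  next
    case (insert i A)
    obtain P where P: "q = poly P (Var i)" "\<And>k. vars (coeff P k) \<subseteq> vars q - {i}"
      using as_univariate by blast
    have "coeff P k = 0" for k
    proof (rule insert.IH)
      show "vars (coeff P k) \<subseteq> A" using P(2)[of k] insert.prems by auto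
    next
      fix v assume v: "\<And>j. v j \<in> S j"
      have "poly (map_poly (eval v) P) x = 0" if x: "x \<in> S i" for x
      proof -
        \<comment> \<open>The coefficients do not contain the variable \<open>i\<close>, so moving
          that coordinate changes only the argument of the univariate polynomial.\<close>
        have "eval (v(i := x)) (coeff P k) = eval v (coeff P k)" for k
          using P(2)[of k] by (intro peval_cong) auto
        then have "map_poly (eval (v(i := x))) P = map_poly (eval v) P"
          by (intro poly_eqI) (simp add: coeff_map_poly)
        then have "poly (map_poly (eval v) P) x = eval (v(i := x)) q"
          by (simp add: P(1) eval_poly)
        also have "\<dots> = 0" using v x by (intro insert.prems) auto
        finally show ?thesis .
      qed
      then have "S i \<subseteq> {x. poly (map_poly (eval v) P) x = 0}" by auto
      then have "map_poly (eval v) P = 0"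
        using inf[of i] poly_roots_finite finite_subset by blast
      then show "eval v (coeff P k) = 0"
        by (metis coeff_0 coeff_map_poly eval.peval_0)
    qed
    then have "P = 0" by (simp add: poly_eq_iff)
    then show ?case using P(1) by simp
  qed
  from this[of "vars p"] assms show ?thesis by auto
qed

text \<open>Setting a variable to 0 is the identity modulo that variable. Consequently a polynomial
  killed by this substitution is a multiple of the variable.\<close>

lemma Var_dvd_diff_subst: "Var i dvd p - subst (Var(i := 0)) p"
proof (induction p rule: mpoly_induct)
  case (add p q)
  have "p + q - subst (Var(i := 0)) (p + q) =
      (p - subst (Var(i := 0)) p) + (q - subst (Var(i := 0)) q)" by simp
  then show ?case using add dvd_add by metis
next
  case (Var p j)
  have "p * Var j - subst (Var(i := 0)) p * Var j = (p - subst (Var(i := 0)) p) * Var j"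
    by (simp add: algebra_simps)
  then have "Var i dvd p * Var j - subst (Var(i := 0)) p * Var j"
    using Var by (metis dvd_mult2)
  then show ?case
    by (cases "j = i") (simp, simp only: subst.peval_mult subst.peval_Var fun_upd_other not_False_eq_True)
qed simp

section \<open>Forms and the coordinate ring\<close>

lemma monom_degree_add: "monom_degree (m + m') = monom_degree m + monom_degree m'"
proof -
  let ?A = "Poly_Mapping.keys m \<union> Poly_Mapping.keys m'"
  have "monom_degree k = (\<Sum>i\<in>?A. Poly_Mapping.lookup k i)" if "Poly_Mapping.keys k \<subseteq> ?A" for k
    unfolding monom_degree_def using that by (intro sum.mono_neutral_left) (auto simp: in_keys_iff)
  then show ?thesis
    using keys_add[of m m'] by (simp add: lookup_add sum.distrib)
qed

lemma carrier_coord_ring: "p \<in> carrier (coord_ring n) \<longleftrightarrow> vars p \<subseteq> coord_idx n"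
  by (simp add: coord_ring_def)

lemma forms_add: "p \<in> forms n d \<Longrightarrow> q \<in> forms n d \<Longrightarrow> p + q \<in> forms n d"
  using vars_add[of p q] keys_add[of p q] unfolding forms_def carrier_coord_ring by blast

lemma forms_minus: "p \<in> forms n d \<Longrightarrow> - p \<in> forms n d"
  using keys_diff[of 0 p] by (auto simp: forms_def carrier_coord_ring)

lemma forms_diff: "p \<in> forms n d \<Longrightarrow> q \<in> forms n d \<Longrightarrow> p - q \<in> forms n d"
  using forms_add[OF _ forms_minus] by fastforce

lemma forms_mult: "p \<in> forms n d \<Longrightarrow> q \<in> forms n e \<Longrightarrow> d + e = k \<Longrightarrow> p * q \<in> forms n k"
proof -
  assume p: "p \<in> forms n d" and q: "q \<in> forms n e" and k: "d + e = k"
  have "monom_degree m = k" if m: "m \<in> Poly_Mapping.keys (p * q)" for m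
  proof -
    obtain a b where "m = a + b" "a \<in> Poly_Mapping.keys p" "b \<in> Poly_Mapping.keys q"
      using m keys_mult[of p q] by blast
    then show ?thesis
      using p q k by (simp add: forms_def monom_degree_add)
  qed
  moreover have "vars (p * q) \<subseteq> coord_idx n"
    using p q vars_mult[of p q] unfolding forms_def carrier_coord_ring by blast
  ultimately show ?thesis unfolding forms_def carrier_coord_ring by blast
qed

lemma forms_1: "1 \<in> forms n 0"
  by (simp add: forms_def carrier_coord_ring monom_degree_def)

lemma forms_numeral: "(numeral k :: 'a::field mpoly) \<in> forms n 0"
proof -
  have "monom_degree m = 0" if "m \<in> Poly_Mapping.keys (numeral k :: 'a mpoly)" for m
    using that by (simp add: single_numeral[symmetric] monom_degree_def del: single_numeral split: if_splits)
  then show ?thesis by (simp add: forms_def carrier_coord_ring)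
qed

lemma forms_power: "p \<in> forms n d \<Longrightarrow> d * e = k \<Longrightarrow> p ^ e \<in> forms n k"
proof (induction e arbitrary: k)
  case (Suc e)
  have "p * p ^ e \<in> forms n k"
    using Suc.prems by (intro forms_mult[OF _ Suc.IH]) auto
  then show ?case by simp
qed (simp add: forms_1)

lemma forms_Var: "i \<in> coord_idx n \<Longrightarrow> Var i \<in> forms n 1"
  by (simp add: forms_def carrier_coord_ring) (simp add: monom_degree_def Var_def)

section \<open>The coordinate ring as a domain, and its principal ideals\<close>

lemma domain_coord_ring: "domain (coord_ring n :: 'k::field mpoly ring)"
proof -
  have "cring (coord_ring n :: 'k mpoly ring)"
  proof (intro cringI abelian_groupI comm_monoidI)
    fix p assume p: "p \<in> carrier (coord_ring n :: 'k mpoly ring)"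
    show "\<exists>q\<in>carrier (coord_ring n). q \<oplus>\<^bsub>coord_ring n\<^esub> p = \<zero>\<^bsub>coord_ring n\<^esub>"
      using p by (intro bexI[of _ "- p"]) (simp_all add: coord_ring_def)
  qed (use vars_add vars_mult in \<open>(simp add: coord_ring_def algebra_simps; blast)+\<close>)
  then show ?thesis
    by (intro domain.intro domain_axioms.intro) (simp_all add: coord_ring_def)
qed

lemma coord_ring_simps:
  "p \<otimes>\<^bsub>coord_ring n\<^esub> q = p * q" "p \<oplus>\<^bsub>coord_ring n\<^esub> q = p + q"
  "\<one>\<^bsub>coord_ring n\<^esub> = 1" "\<zero>\<^bsub>coord_ring n\<^esub> = 0"
  by (simp_all add: coord_ring_def)

lemma mem_principal_ideal:
  fixes f :: "'a::field mpoly"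
  assumes f: "vars f \<subseteq> coord_idx n"
  shows "p \<in> Idl\<^bsub>coord_ring n\<^esub> {f} \<longleftrightarrow> vars p \<subseteq> coord_idx n \<and> f dvd p"
proof -
  interpret domain "coord_ring n :: 'a mpoly ring" by (rule domain_coord_ring)
  have "f \<in> carrier (coord_ring n)" using f by (simp only: carrier_coord_ring)
  then have I: "Idl\<^bsub>coord_ring n\<^esub> {f} = {x * f |x. vars x \<subseteq> coord_idx n}"
    by (simp only: cgenideal_eq_genideal[symmetric] cgenideal_def carrier_coord_ring coord_ring_simps)
  show ?thesis
  proof
    assume "p \<in> Idl\<^bsub>coord_ring n\<^esub> {f}"
    then obtain x where x: "p = x * f" "vars x \<subseteq> coord_idx n" using I by blast
    then show "vars p \<subseteq> coord_idx n \<and> f dvd p"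
      unfolding x(1) using vars_mult[of x f] f dvd_triv_right[of f x] by blast
  next
    assume p: "vars p \<subseteq> coord_idx n \<and> f dvd p"
    then obtain r where r: "p = f * r" by blast
    \<comment> \<open>The cofactor \<open>r\<close> may contain variables that are not coordinates.
      Setting these to 0 fixes \<open>f\<close> and \<open>p\<close> and moves the cofactor into the
      coordinate ring.\<close>
    define \<pi> where "\<pi> i = (if i \<in> coord_idx n then Var i else 0 :: 'a mpoly)" for i
    have id: "subst \<pi> q = q" if "vars q \<subseteq> coord_idx n" for q
      using that subst_cong[of q \<pi> Var] by (simp add: \<pi>_def subset_iff)
    have "p = subst \<pi> p" using id p by simp
    also have "\<dots> = subst \<pi> r * f" using id[OF f] by (simp add: r)
    finally have "p = subst \<pi> r * f" .
    moreover have "vars (subst \<pi> r) \<subseteq> coord_idx n"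
      using vars_subst[of \<pi> r] by (auto simp: \<pi>_def split: if_splits)
    ultimately show "p \<in> Idl\<^bsub>coord_ring n\<^esub> {f}" unfolding I by blast
  qed
qed

section \<open>The kernel parametrisation\<close>

text \<open>
  The maps are stated over an arbitrary commutative ring, so that one identity serves both for
  polynomials and for real points. The vector (ker1, ker2, ker3) is the cross product of
  the first two rows of the matrix.
\<close>

definition cubic :: "(nat \<Rightarrow> 'a::comm_ring_1) \<Rightarrow> 'a" where
  "cubic x = x 1 ^ 2 * x 2 + x 1 * x 2 ^ 2 + x 2 * x 3 ^ 2 + x 1 * x 4 ^ 2
     - 2 * x 3 * x 4 * x 5 - (x 1 + x 2) * x 5 ^ 2"

definition ker1 :: "(nat \<Rightarrow> 'a::comm_ring_1) \<Rightarrow> 'a" where "ker1 x = x 5 * x 4 - x 3 * x 2"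
definition ker2 :: "(nat \<Rightarrow> 'a::comm_ring_1) \<Rightarrow> 'a" where "ker2 x = x 3 * x 5 - x 1 * x 4"
definition ker3 :: "(nat \<Rightarrow> 'a::comm_ring_1) \<Rightarrow> 'a" where "ker3 x = x 1 * x 2 - x 5 ^ 2"

text \<open>
  In the coordinates of the introduction, \<open>kernel_map\<close> is (s : t : u : 1) and \<open>matrix_map\<close> is its
  inverse, normalised by x1 = 1 + t^2; both are homogenised by clearing denominators.
\<close>

definition kernel_map :: "(nat \<Rightarrow> 'a::comm_ring_1) \<Rightarrow> nat \<Rightarrow> 'a" where
  "kernel_map x i = (if i = 1 then ker1 x * x 1 else if i = 2 then ker2 x * x 1
     else if i = 3 then ker3 x * x 5 else if i = 4 then ker3 x * x 1 else 0)"

definition matrix_map :: "(nat \<Rightarrow> 'a::comm_ring_1) \<Rightarrow> nat \<Rightarrow> 'a" where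
  "matrix_map y i =
    (if i = 1 then y 4 ^ 2 * (y 4 ^ 2 + y 2 ^ 2)
     else if i = 2 then - (y 4 ^ 2 * (y 4 ^ 2 + y 1 ^ 2) + 2 * y 1 * y 2 * y 3 * y 4)
     else if i = 3 then - (y 1 * y 4 + y 3 * y 2) * (y 4 ^ 2 + y 2 ^ 2)
     else if i = 4 then y 3 * y 1 * (y 2 ^ 2 - y 4 ^ 2) + y 2 * y 4 * (y 4 ^ 2 + y 1 ^ 2)
     else if i = 5 then y 3 * y 4 * (y 4 ^ 2 + y 2 ^ 2)
     else 0)"

lemma kernel_map_simps:
  "kernel_map x 1 = ker1 x * x 1" "kernel_map x 2 = ker2 x * x 1"
  "kernel_map x 3 = ker3 x * x 5" "kernel_map x 4 = ker3 x * x 1"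
  by (simp_all add: kernel_map_def)

lemma matrix_map_simps:
  "matrix_map y 1 = y 4 ^ 2 * (y 4 ^ 2 + y 2 ^ 2)"
  "matrix_map y 2 = - (y 4 ^ 2 * (y 4 ^ 2 + y 1 ^ 2) + 2 * y 1 * y 2 * y 3 * y 4)"
  "matrix_map y 3 = - (y 1 * y 4 + y 3 * y 2) * (y 4 ^ 2 + y 2 ^ 2)"
  "matrix_map y 4 = y 3 * y 1 * (y 2 ^ 2 - y 4 ^ 2) + y 2 * y 4 * (y 4 ^ 2 + y 1 ^ 2)"
  "matrix_map y 5 = y 3 * y 4 * (y 4 ^ 2 + y 2 ^ 2)"
  by (simp_all add: matrix_map_def)

lemma coord_idx_cases:
  "i \<in> coord_idx 4 \<longleftrightarrow> i = 1 \<or> i = 2 \<or> i = 3 \<or> i = 4 \<or> i = 5"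
  "i \<in> coord_idx 3 \<longleftrightarrow> i = 1 \<or> i = 2 \<or> i = 3 \<or> i = 4"
  by auto

text \<open>A cross product k is orthogonal to both of its factors, here the first two rows of the
  matrix M. In the quadratic form of M at k only the third row contributes, which gives
  \<open>ker3 x\<close> times det M = \<open>- cubic x\<close>; eliminating \<open>x 3\<close> and
  \<open>x 4\<close> by the first two identities turns its negative into the third.\<close>

lemma ker_eqs:
  fixes x :: "nat \<Rightarrow> 'a::comm_ring_1"
  shows "x 1 * ker1 x + x 5 * ker2 x + x 3 * ker3 x = 0"
    and "x 5 * ker1 x + x 2 * ker2 x + x 4 * ker3 x = 0"
    and "x 1 * (ker1 x ^ 2 + ker3 x ^ 2) + 2 * x 5 * ker1 x * ker2 x + x 2 * (ker2 x ^ 2 + ker3 x ^ 2)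
      = ker3 x * cubic x"
  unfolding ker1_def ker2_def ker3_def cubic_def
  by (simp_all add: algebra_simps power2_eq_square)

text \<open>The matrix with these entries annihilates the vector (\<open>y 1\<close>,
  \<open>y 2\<close>, \<open>y 4\<close>), so its determinant is 0.\<close>

lemma cubic_matrix_map: "cubic (matrix_map y) = 0"
  unfolding cubic_def matrix_map_simps by (simp add: algebra_simps power2_eq_square)

lemma cubic_scale: "cubic (\<lambda>i. w * x i) = w ^ 3 * cubic x"
  unfolding cubic_def by (simp add: algebra_simps power2_eq_square power3_eq_cube)

text \<open>The factor of the round trip from X to itself, read off from the first coordinate of
  \<open>matrix_map (kernel_map x)\<close>.\<close>

definition scale :: "(nat \<Rightarrow> 'a::comm_ring_1) \<Rightarrow> 'a" where
  "scale x = x 1 ^ 3 * ker3 x ^ 2 * (ker2 x ^ 2 + ker3 x ^ 2)"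

text \<open>Coordinates 1, 3 and 5 agree exactly. Coordinates 2 and 4 use the third relation of
  \<open>ker_eqs\<close>, which holds only modulo the cubic; hence the correction term.\<close>

lemma matrix_map_kernel_map:
  fixes x :: "nat \<Rightarrow> 'a::comm_ring_1"
  assumes "i \<in> coord_idx 4"
  shows "\<exists>c. matrix_map (kernel_map x) i = scale x * x i + cubic x * c"
proof -
  \<comment> \<open>Treating the kernel vector as three atoms keeps the expansions small; its
    entries enter only through the relations \<open>e\<close>.\<close>
  define a b c where "a = ker1 x" and "b = ker2 x" and "c = ker3 x"
  note e = ker_eqs[of x, folded a_def b_def c_def]
  note unf = matrix_map_simps kernel_map_simps scale_def a_def[symmetric] b_def[symmetric] c_def[symmetric]
  have 1: "matrix_map (kernel_map x) 1 = scale x * x 1 + cubic x * 0"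
    unfolding unf by (simp add: algebra_simps power2_eq_square power3_eq_cube)
  have "matrix_map (kernel_map x) 2 = - (x 1 ^ 3 * c ^ 2) * (x 1 * (a ^ 2 + c ^ 2) + 2 * x 5 * a * b)"
    unfolding unf by (simp add: algebra_simps power2_eq_square power3_eq_cube)
  also have "x 1 * (a ^ 2 + c ^ 2) + 2 * x 5 * a * b = c * cubic x - x 2 * (b ^ 2 + c ^ 2)"
    using e(3) by (simp add: algebra_simps)
  finally have 2: "matrix_map (kernel_map x) 2 = scale x * x 2 + cubic x * (- (x 1 ^ 3 * c ^ 3))"
    unfolding unf by (simp add: algebra_simps power2_eq_square power3_eq_cube)
  have "matrix_map (kernel_map x) 3 = - (x 1 ^ 3 * c * (b ^ 2 + c ^ 2)) * (x 1 * a + x 5 * b)"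
    unfolding unf by (simp add: algebra_simps power2_eq_square power3_eq_cube)
  also have "x 1 * a + x 5 * b = - (x 3 * c)"
    using e(1) by (simp add: eq_neg_iff_add_eq_0)
  finally have 3: "matrix_map (kernel_map x) 3 = scale x * x 3 + cubic x * 0"
    unfolding unf by (simp add: algebra_simps power2_eq_square power3_eq_cube)
  have "matrix_map (kernel_map x) 4 = x 1 ^ 3 * c *
      (b * (x 1 * (a ^ 2 + c ^ 2) + 2 * x 5 * a * b + x 2 * (b ^ 2 + c ^ 2)) - (b ^ 2 + c ^ 2) * (x 5 * a + x 2 * b))"
    unfolding unf by (simp add: algebra_simps power2_eq_square power3_eq_cube)
  also have "x 5 * a + x 2 * b = - (x 4 * c)"
    using e(2) by (simp add: eq_neg_iff_add_eq_0)
  finally have 4: "matrix_map (kernel_map x) 4 = scale x * x 4 + cubic x * (x 1 ^ 3 * c ^ 2 * b)"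
    unfolding unf e(3) by (simp add: algebra_simps power2_eq_square power3_eq_cube)
  have 5: "matrix_map (kernel_map x) 5 = scale x * x 5 + cubic x * 0"
    unfolding unf by (simp add: algebra_simps power2_eq_square power3_eq_cube)
  show ?thesis
    using assms[unfolded coord_idx_cases] by (elim disjE; hypsubst) (blast intro: 1 2 3 4 5)+
qed

text \<open>The factor of the round trip on projective 3-space, read off from the fourth coordinate,
  \<open>ker3 * x1\<close> at the image matrix.\<close>

definition coscale :: "(nat \<Rightarrow> 'a::comm_ring_1) \<Rightarrow> 'a" where
  "coscale y = - (y 4 ^ 3 * (y 4 ^ 2 + y 2 ^ 2) ^ 2 *
     (y 4 ^ 2 * (y 4 ^ 2 + y 1 ^ 2) + 2 * y 1 * y 2 * y 3 * y 4 + y 3 ^ 2 * (y 4 ^ 2 + y 2 ^ 2)))"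

lemma kernel_map_matrix_map:
  fixes y :: "nat \<Rightarrow> 'a::comm_ring_1"
  assumes "i \<in> coord_idx 3"
  shows "kernel_map (matrix_map y) i = coscale y * y i"
proof -
  have "kernel_map (matrix_map y) 1 = coscale y * y 1"
    unfolding matrix_map_simps kernel_map_simps ker1_def coscale_def by (simp add: algebra_simps power2_eq_square power3_eq_cube)
  moreover have "kernel_map (matrix_map y) 2 = coscale y * y 2"
    unfolding matrix_map_simps kernel_map_simps ker2_def coscale_def by (simp add: algebra_simps power2_eq_square power3_eq_cube)
  moreover have "kernel_map (matrix_map y) 3 = coscale y * y 3"
    unfolding matrix_map_simps kernel_map_simps ker3_def coscale_def by (simp add: algebra_simps power2_eq_square power3_eq_cube)
  moreover have "kernel_map (matrix_map y) 4 = coscale y * y 4"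
    unfolding matrix_map_simps kernel_map_simps ker3_def coscale_def by (simp add: algebra_simps power2_eq_square power3_eq_cube)
  ultimately show ?thesis
    using assms unfolding coord_idx_cases by (elim disjE) simp_all
qed

section \<open>Primality of the cubic\<close>

text \<open>The three maps are polynomial expressions with integer coefficients, so they commute
  with every evaluation and substitution.\<close>

lemma (in coeff_hom) peval_maps:
  "peval c f (cubic x) = cubic (\<lambda>i. peval c f (x i))"
  "peval c f (kernel_map x i) = kernel_map (\<lambda>i. peval c f (x i)) i"
  "peval c f (matrix_map x i) = matrix_map (\<lambda>i. peval c f (x i)) i"
  by (simp_all add: cubic_def kernel_map_def matrix_map_def ker1_def ker2_def ker3_def)

text \<open>The cubic is quadratic in x3 with leading coefficient x2, so division with remainder
  works after multiplying by a power of x2.\<close>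

lemma pseudo_division:
  fixes p :: "'k::field mpoly"
  shows "\<exists>N q a b. Var 2 ^ N * p = q * cubic Var + a * Var 3 + b \<and> 3 \<notin> vars a \<and> 3 \<notin> vars b"
proof (induction p rule: mpoly_induct)
  case (Const c)
  show ?case
    by (rule exI[of _ 0], rule exI[of _ 0], rule exI[of _ 0], rule exI[of _ "Const c"]) simp
next
  case (add p p')
  then obtain N q a b N' q' a' b' where
    p: "Var 2 ^ N * p = q * cubic Var + a * Var 3 + b" "3 \<notin> vars a" "3 \<notin> vars b" and
    p': "Var 2 ^ N' * p' = q' * cubic Var + a' * Var 3 + b'" "3 \<notin> vars a'" "3 \<notin> vars b'"
    by blast
  have "Var 2 ^ (N + N') * (p + p') = Var 2 ^ N' * (Var 2 ^ N * p) + Var 2 ^ N * (Var 2 ^ N' * p')"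
    by (simp add: power_add algebra_simps)
  also have "\<dots> = (Var 2 ^ N' * q + Var 2 ^ N * q') * cubic Var +
      (Var 2 ^ N' * a + Var 2 ^ N * a') * Var 3 + (Var 2 ^ N' * b + Var 2 ^ N * b')"
    unfolding p(1) p'(1) by (simp add: algebra_simps)
  moreover have "3 \<notin> vars (Var 2 ^ N' * a + Var 2 ^ N * a')" "3 \<notin> vars (Var 2 ^ N' * b + Var 2 ^ N * b')"
    using p p' by (simp_all add: notin_vars_intros)
  ultimately show ?case by metis
next
  case (Var p i)
  then obtain N q a b where
    p: "Var 2 ^ N * p = q * cubic Var + a * Var 3 + b" "3 \<notin> vars a" "3 \<notin> vars b"
    by blast
  show ?case
  proof (cases "i = 3")
    case True
    let ?C = "Var 1 ^ 2 * Var 2 + Var 1 * Var 2 ^ 2 + Var 1 * Var 4 ^ 2 - (Var 1 + Var 2) * Var 5 ^ 2 :: 'k mpoly"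
    \<comment> \<open>One more factor x2 turns the new term in x3^2 into x2 x3^2, which is replaced
      by \<open>cubic Var\<close> + 2 x3 x4 x5 - \<open>?C\<close>.\<close>
    have "Var 2 ^ Suc N * (p * Var i) = Var 2 * Var 3 * (Var 2 ^ N * p)"
      by (simp add: True algebra_simps)
    also have "\<dots> = (Var 2 * Var 3 * q + a) * cubic Var +
        (Var 2 * b + 2 * a * Var 4 * Var 5) * Var 3 + (- (a * ?C))"
      unfolding p(1) by (simp add: cubic_def algebra_simps power2_eq_square)
    moreover have "3 \<notin> vars (Var 2 * b + 2 * a * Var 4 * Var 5)" "3 \<notin> vars (- (a * ?C))"
      using p by (simp_all add: notin_vars_intros)
    ultimately show ?thesis by metis
  next
    case False
    have "Var 2 ^ N * (p * Var i) = (Var 2 ^ N * p) * Var i" by (simp add: algebra_simps)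
    also have "\<dots> = (q * Var i) * cubic Var + (a * Var i) * Var 3 + b * Var i"
      unfolding p(1) by (simp add: algebra_simps)
    moreover have "3 \<notin> vars (a * Var i)" "3 \<notin> vars (b * Var i)"
      using p False by (simp_all add: notin_vars_intros)
    ultimately show ?thesis by metis
  qed
qed

lemma Var_neq_0 [simp]: "Var i \<noteq> (0 :: 'k::field mpoly)"
  using eval.peval_Var[of "\<lambda>_. 1" i] by (metis eval.peval_0 zero_neq_one)

text \<open>At x2 = 0 the cubic stays nonzero while the product vanishes. So the cofactor vanishes
  at x2 = 0, is divisible by x2, and x2 can be cancelled.\<close>

lemma cubic_dvd_cancel:
  fixes p :: "'k::field mpoly"
  assumes "cubic Var dvd Var 2 * p"
  shows "cubic Var dvd p"
proof -
  from assms obtain q where q: "Var 2 * p = cubic Var * q" by blast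
  define \<sigma> :: "nat \<Rightarrow> 'k mpoly" where "\<sigma> = Var(2 := 0)"
  have "subst \<sigma> (cubic Var) * subst \<sigma> q = subst \<sigma> (Var 2) * subst \<sigma> p"
    by (simp only: subst.peval_mult[symmetric] q)
  moreover have "\<sigma> 2 = 0" by (simp add: \<sigma>_def)
  ultimately have "cubic \<sigma> = 0 \<or> subst \<sigma> q = 0"
    by (simp add: subst.peval_maps)
  moreover have "cubic \<sigma> \<noteq> 0"
  proof
    assume "cubic \<sigma> = 0"
    \<comment> \<open>At x2 = 0 the cubic is x1 x4^2 - 2 x3 x4 x5 - x1 x5^2, with value 1 at this
      point.\<close>
    then have "eval (\<lambda>i. if i = 1 \<or> i = 4 then 1 else 0) (cubic \<sigma>) = 0" by simp
    then show False by (simp add: cubic_def \<sigma>_def)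
  qed
  ultimately have "Var 2 dvd q" using Var_dvd_diff_subst[of 2 q] by (simp add: \<sigma>_def)
  then obtain r where "q = Var 2 * r" by blast
  then have "Var 2 * p = Var 2 * (cubic Var * r)"
    unfolding q by (simp only: mult.left_commute)
  then have "p = cubic Var * r" by simp
  then show ?thesis by simp
qed

lemma cubic_dvd_cancel_power:
  fixes p :: "'k::field mpoly"
  shows "cubic Var dvd Var 2 ^ N * p \<Longrightarrow> cubic Var dvd p"
  by (induction N) (auto simp: mult.assoc dest: cubic_dvd_cancel)

lemma cubic_dvd_if_vanishes:
  fixes p :: "real mpoly"
  assumes "\<And>v. 0 < v 1 \<Longrightarrow> v 1 < 1 \<Longrightarrow> v 2 < - 1 \<Longrightarrow> cubic v = 0 \<Longrightarrow> eval v p = 0"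
  shows "cubic Var dvd p"
proof -
  obtain N q a b where p: "Var 2 ^ N * p = q * cubic Var + a * Var 3 + b" "3 \<notin> vars a" "3 \<notin> vars b"
    using pseudo_division[of p] by blast
  \<comment> \<open>Only x1 and x2 are constrained: the bounds force x2 < 0 and x1 + x2 < 0, while
    x4 and x5 stay free.\<close>
  define S :: "nat \<Rightarrow> real set" where "S i = (if i = 1 then {0<..<1} else if i = 2 then {..<-1} else UNIV)" for i
  have S: "infinite (S i)" for i
    by (simp add: S_def infinite_Ioo infinite_Iio infinite_UNIV_char_0)
  have "eval v a = 0 \<and> eval v b = 0" if v: "\<And>i. v i \<in> S i" for v
  proof -
    have v12: "0 < v 1" "v 1 < 1" "v 2 < -1"
      using v[of 1] v[of 2] by (simp_all add: S_def)
    define C where "C = v 1 ^ 2 * v 2 + v 1 * v 2 ^ 2 + v 1 * v 4 ^ 2 - (v 1 + v 2) * v 5 ^ 2"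
    define D where "D = (v 4 * v 5) ^ 2 - v 2 * C"
    \<comment> \<open>This is the part of \<open>C\<close> without \<open>v 4\<close> and
      \<open>v 5\<close>; the other two terms are nonnegative.\<close>
    have "0 < v 1 * v 2 * (v 1 + v 2)" using v12 by (intro mult_neg_neg) (auto simp: mult_pos_neg)
    moreover have "0 \<le> v 1 * v 4 ^ 2" "0 \<le> - (v 1 + v 2) * v 5 ^ 2" using v12 by auto
    ultimately have "0 < C" by (simp add: C_def algebra_simps power2_eq_square)
    then have "v 2 * C < 0" using v12 by (intro mult_neg_pos) auto
    then have D: "0 < D" unfolding D_def by (smt (verit) zero_le_power2)
    \<comment> \<open>\<open>D\<close> is a quarter of the discriminant of the cubic as a quadratic polynomial in the third variable.\<close>
    have lin: "eval v a * r + eval v b = 0" if r: "r = (v 4 * v 5 + s) / v 2" "s ^ 2 = D" for r s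
    proof -
      let ?w = "v(3 := r)"
      have "v 2 * r - v 4 * v 5 = s" using r v12 by simp
      then have "(v 2 * r - v 4 * v 5) ^ 2 = D" using r by simp
      \<comment> \<open>Completing the square, read backwards: \<open>r\<close> is a root of the
        cubic in its third variable.\<close>
      then have "v 2 * (v 2 * r ^ 2 - 2 * r * v 4 * v 5 + C) = 0"
        by (simp add: D_def algebra_simps power2_eq_square)
      then have "v 2 * r ^ 2 - 2 * r * v 4 * v 5 + C = 0" using v12 by simp
      then have cub: "cubic ?w = 0" by (simp add: cubic_def C_def)
      then have "eval ?w p = 0" using v12 by (intro assms) auto
      then have "eval ?w (Var 2 ^ N * p) = 0" by simp
      then have "eval ?w a * r + eval ?w b = 0"
        using cub unfolding p(1) by (simp add: eval.peval_maps del: fun_upd_apply) simp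
      moreover have "eval ?w a = eval v a" "eval ?w b = eval v b"
        using p by (auto intro!: peval_cong)
      ultimately show ?thesis by simp
    qed
    have "eval v a * ((v 4 * v 5 + sqrt D) / v 2) + eval v b = 0"
      "eval v a * ((v 4 * v 5 + - sqrt D) / v 2) + eval v b = 0"
      using D lin[OF refl, of "sqrt D"] lin[OF refl, of "- sqrt D"] by simp_all
    then have "eval v a * ((v 4 * v 5 + sqrt D) / v 2) = eval v a * ((v 4 * v 5 + - sqrt D) / v 2)"
      by (metis add_right_cancel)
    \<comment> \<open>Two distinct zeros of a polynomial of degree at most one force its slope, and
      then its constant term, to be 0.\<close>
    moreover have "(v 4 * v 5 + sqrt D) / v 2 \<noteq> (v 4 * v 5 + - sqrt D) / v 2"
      using D v12 by (simp add: divide_simps)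
    ultimately have "eval v a = 0" by (metis mult_left_cancel)
    then show ?thesis using lin[of _ "sqrt D"] D by simp
  qed
  then have "a = 0" "b = 0"
    using mpoly_eq_0_on_box[of S a] mpoly_eq_0_on_box[of S b] S by blast+
  then have "cubic Var dvd Var 2 ^ N * p" using p(1) by simp
  then show ?thesis by (rule cubic_dvd_cancel_power)
qed

text \<open>This presents the ideal as the kernel of a homomorphism into an integral domain, which
  yields primality. Since \<open>matrix_map\<close> reads only coordinates 1 to 4,
  \<open>Var 5\<close> is a free scaling parameter, giving a map to the affine cone over X.\<close>

lemma cubic_dvd_iff:
  fixes p :: "real mpoly"
  assumes p: "vars p \<subseteq> coord_idx 4"
  shows "cubic Var dvd p \<longleftrightarrow> subst (\<lambda>i. Var 5 * matrix_map Var i) p = 0"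
proof
  assume "cubic Var dvd p"
  then obtain q where "p = cubic Var * q" by blast
  then show "subst (\<lambda>i. Var 5 * matrix_map Var i) p = 0"
    by (simp add: subst.peval_maps cubic_scale cubic_matrix_map)
next
  assume *: "subst (\<lambda>i. Var 5 * matrix_map Var i) p = 0"
  show "cubic Var dvd p"
  proof (rule cubic_dvd_if_vanishes)
    fix v :: "nat \<Rightarrow> real"
    assume v: "0 < v 1" "v 1 < 1" "v 2 < - 1" "cubic v = 0"
    \<comment> \<open>The sign conditions keep \<open>ker3 v\<close> away from 0, so the kernel
      parametrisation can be inverted at \<open>v\<close>.\<close>
    have "v 1 * v 2 < 0" using v by (intro mult_pos_neg) auto
    then have "ker3 v < 0" unfolding ker3_def by (smt (verit) zero_le_power2)
    then have "0 < ker2 v ^ 2 + ker3 v ^ 2" by (simp add: add_nonneg_pos)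
    then have nz: "scale v \<noteq> 0"
      using v \<open>ker3 v < 0\<close> by (simp add: scale_def)
    \<comment> \<open>\<open>p\<close> need not be homogeneous, so the factor \<open>scale v\<close> has to be undone by \<open>Var 5\<close>.\<close>
    define u where "u = (kernel_map v)(5 := 1 / scale v)"
    have "eval u (Var 5 * matrix_map Var i) = v i" if i: "i \<in> coord_idx 4" for i
    proof -
      obtain c where c: "matrix_map (kernel_map v) i = scale v * v i + cubic v * c"
        using matrix_map_kernel_map[OF i] by blast
      have "matrix_map u i = matrix_map (kernel_map v) i"
        by (simp add: matrix_map_def u_def)
      then show ?thesis
        using c v nz by (simp add: eval.peval_maps) (simp add: u_def)
    qed
    then have "eval v p = eval (\<lambda>i. eval u (Var 5 * matrix_map Var i)) p"
      using p by (intro peval_cong) auto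
    also have "\<dots> = eval u (subst (\<lambda>i. Var 5 * matrix_map Var i) p)"
      by (rule eval_subst[symmetric])
    finally show "eval v p = 0" using * by simp
  qed
qed

lemma chordal_cubic_form_eq: "chordal_cubic_form = cubic Var"
  by (simp add: chordal_cubic_form_def cubic_def)

section \<open>Forms under substitution, and the degrees of the two maps\<close>

lemma forms_0: "0 \<in> forms n d"
  by (simp add: forms_def carrier_coord_ring)

lemma forms_Const: "Const c \<in> forms n 0"
  by (auto simp: forms_def carrier_coord_ring) (auto simp: Const_def monom_degree_def split: if_splits)

lemma forms_sum: "(\<And>a. a \<in> A \<Longrightarrow> g a \<in> forms n d) \<Longrightarrow> sum g A \<in> forms n d"
  by (induction A rule: infinite_finite_induct) (simp_all add: forms_0 forms_add)

lemma forms_prod: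
  "(\<And>a. a \<in> A \<Longrightarrow> g a \<in> forms n (e a)) \<Longrightarrow> prod g A \<in> forms n (sum e A)"
  by (induction A rule: infinite_finite_induct) (simp_all add: forms_1 forms_mult[OF _ _ refl])

lemma forms_subst:
  assumes p: "p \<in> forms m e" and f: "\<And>i. i \<in> coord_idx m \<Longrightarrow> f i \<in> forms n d"
  shows "subst f p \<in> forms n (d * e)"
  unfolding subst_def
proof (rule forms_sum)
  fix k assume k: "k \<in> Poly_Mapping.keys p"
  have "(\<Prod>i\<in>Poly_Mapping.keys k. f i ^ Poly_Mapping.lookup k i) \<in>
      forms n (\<Sum>i\<in>Poly_Mapping.keys k. d * Poly_Mapping.lookup k i)"
  proof (rule forms_prod)
    fix i assume "i \<in> Poly_Mapping.keys k"
    then have "i \<in> vars p" using k by (auto simp: vars_def)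
    then have "i \<in> coord_idx m" using p unfolding forms_def carrier_coord_ring by blast
    then show "f i ^ Poly_Mapping.lookup k i \<in> forms n (d * Poly_Mapping.lookup k i)"
      by (intro forms_power[OF f refl])
  qed
  moreover have "(\<Sum>i\<in>Poly_Mapping.keys k. d * Poly_Mapping.lookup k i) = d * e"
    using p k by (simp add: forms_def monom_degree_def sum_distrib_left[symmetric])
  ultimately show "Const (Poly_Mapping.lookup p k) * (\<Prod>i\<in>Poly_Mapping.keys k. f i ^ Poly_Mapping.lookup k i) \<in> forms n (d * e)"
    by (simp add: forms_mult[OF forms_Const])
qed

lemma forms_Var_mult: "i \<in> coord_idx n \<Longrightarrow> p \<in> forms n d \<Longrightarrow> Var i * p \<in> forms n (Suc d)"
  by (rule forms_mult[OF forms_Var]) simp_all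

lemma forms_numeral_mult: "p \<in> forms n d \<Longrightarrow> numeral k * p \<in> forms n d"
  by (rule forms_mult[OF forms_numeral]) simp_all

text \<open>These rules peel one variable off each monomial, which is why degrees are unfolded to
  successors and the last rule has degree \<open>Suc 0\<close>.\<close>

lemmas forms_intros = forms_add forms_diff forms_minus forms_numeral_mult forms_Var_mult
  forms_Var[unfolded One_nat_def]

lemma cubic_forms: "cubic Var \<in> forms 4 3"
  by (simp add: cubic_def algebra_simps power2_eq_square eval_nat_numeral(2,3))
     (intro forms_intros; simp)

lemma kernel_map_forms: "kernel_map Var i \<in> forms 4 3"
  by (simp add: kernel_map_def ker1_def ker2_def ker3_def forms_0 algebra_simps power2_eq_square eval_nat_numeral(2,3))
     (intro conjI impI forms_intros; simp)

lemma matrix_map_forms: "matrix_map Var i \<in> forms 3 4"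
  by (simp add: matrix_map_def forms_0 algebra_simps power2_eq_square eval_nat_numeral(2,3))
     (intro conjI impI forms_intros; simp)

section \<open>Membership in the ideal of the cubic\<close>

lemma mem_chordal_cubic: "p \<in> chordal_cubic \<longleftrightarrow> vars p \<subseteq> coord_idx 4 \<and> cubic Var dvd p"
  unfolding chordal_cubic_def chordal_cubic_form_eq
  using cubic_forms[where 'a = real] by (intro mem_principal_ideal) (simp add: forms_def carrier_coord_ring)

text \<open>Multiples of the cubic vanish at all its zeros, so a single real point of the cone
  certifies non-membership.\<close>

lemma notin_chordal_cubic:
  assumes "cubic v = 0" "eval v p \<noteq> 0"
  shows "p \<notin> chordal_cubic"
proof
  assume "p \<in> chordal_cubic"
  then obtain q where "p = cubic Var * q" by (auto simp: mem_chordal_cubic)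
  then show False using assms by (simp add: eval.peval_maps)
qed

lemma primeideal_chordal_cubic: "primeideal chordal_cubic (coord_ring 4)"
proof (rule primeidealI)
  interpret domain "coord_ring 4 :: real mpoly ring" by (rule domain_coord_ring)
  show "cring (coord_ring 4 :: real mpoly ring)" by (rule is_cring)
  show "ideal chordal_cubic (coord_ring 4)"
    unfolding chordal_cubic_def chordal_cubic_form_eq
    using cubic_forms[where 'a = real] by (intro genideal_ideal) (simp add: forms_def)
  have "(1 :: real mpoly) \<notin> chordal_cubic"
    by (rule notin_chordal_cubic[of "\<lambda>_. 0"]) (simp_all add: cubic_def)
  moreover have "(1 :: real mpoly) \<in> carrier (coord_ring 4)"
    by (simp add: carrier_coord_ring)
  ultimately show "carrier (coord_ring 4) \<noteq> chordal_cubic"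
    by blast
  fix p q :: "real mpoly"
  assume "p \<in> carrier (coord_ring 4)" "q \<in> carrier (coord_ring 4)"
    and pq: "p \<otimes>\<^bsub>coord_ring 4\<^esub> q \<in> chordal_cubic"
  then have vars: "vars p \<subseteq> coord_idx 4" "vars q \<subseteq> coord_idx 4"
    by (simp_all only: carrier_coord_ring)
  have "subst (\<lambda>i. Var 5 * matrix_map Var i) (p * q) = 0"
    using pq cubic_dvd_iff[of "p * q"] by (simp only: mem_chordal_cubic coord_ring_simps)
  \<comment> \<open>The substitution is multiplicative and polynomials have no zero divisors, so one
    of the two images is 0.\<close>
  then show "p \<in> chordal_cubic \<or> q \<in> chordal_cubic"
    using vars cubic_dvd_iff by (simp add: mem_chordal_cubic)
qed

section \<open>Rationality\<close>

lemma proj_variety_chordal_cubic: "proj_variety 4 chordal_cubic"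
  unfolding proj_variety_def
proof (intro conjI)
  have "cubic Var \<in> (\<Union>d. forms 4 d :: real mpoly set)"
    using cubic_forms[where 'a = real] by (simp only: UN_iff) (rule bexI[of _ 3], assumption, rule UNIV_I)
  then have "{cubic Var} \<subseteq> (\<Union>d. forms 4 d :: real mpoly set)" by simp
  then show "homogeneous_ideal 4 chordal_cubic"
    unfolding homogeneous_ideal_def chordal_cubic_def chordal_cubic_form_eq
    by (intro exI[of _ "{cubic Var}"]) simp
  \<comment> \<open>The diagonal matrix with entries 1, -1, 0: traceless and singular, hence a real
    point of X.\<close>
  define v :: "nat \<Rightarrow> real" where "v = (\<lambda>_. 0)(1 := 1, 2 := - 1)"
  have "cubic v = 0" by (simp add: v_def cubic_def)
  then have "Var 1 \<notin> chordal_cubic"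
    by (rule notin_chordal_cubic) (simp add: v_def)
  then show "\<exists>i\<in>coord_idx 4. Var i \<notin> chordal_cubic"
    by (rule bexI) simp
qed (rule primeideal_chordal_cubic)

lemma rat_mapI:
  assumes "\<And>j. \<phi> j \<in> forms n d" "i \<in> coord_idx m" "\<phi> i \<notin> I"
  shows "rat_map n I m \<phi>"
  unfolding rat_map_def using assms by blast

lemma proj_variety_projective_space: "proj_variety n ({0} :: 'k::field mpoly set)"
proof -
  interpret domain "coord_ring n :: 'k mpoly ring" by (rule domain_coord_ring)
  have "primeideal {0} (coord_ring n :: 'k mpoly ring)"
    using zeroprimeideal by (simp only: coord_ring_simps)
  moreover have "{0} = Idl\<^bsub>coord_ring n\<^esub> {0 :: 'k mpoly}"
    using genideal_zero by (simp only: coord_ring_simps)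
  moreover have "{0} \<subseteq> (\<Union>d. forms n d :: 'k mpoly set)"
    using forms_0 by blast
  ultimately have "homogeneous_ideal n ({0} :: 'k mpoly set)" "primeideal {0} (coord_ring n :: 'k mpoly ring)"
    unfolding homogeneous_ideal_def by blast+
  moreover have "1 \<in> coord_idx n" "Var 1 \<notin> ({0} :: 'k mpoly set)" by simp_all
  ultimately show ?thesis unfolding proj_variety_def by blast
qed

theorem proposition7p3:
  shows "rational_variety 3 4 chordal_cubic"
proof -
  let ?\<phi> = "kernel_map Var :: nat \<Rightarrow> real mpoly" and ?\<psi> = "matrix_map Var :: nat \<Rightarrow> real mpoly"
  \<comment> \<open>Both \<open>kernel_map\<close> and the composite are defined at this diagonal
    matrix, which has kernel vector (0, 0, -1).\<close>
  define v :: "nat \<Rightarrow> real" where "v = (\<lambda>_. 0)(1 := 1, 2 := - 1)"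
  have v: "cubic v = 0" by (simp add: v_def cubic_def)
  have comp_\<psi>\<phi>: "comp_tuple ?\<psi> ?\<phi> = matrix_map ?\<phi>" and comp_\<phi>\<psi>: "comp_tuple ?\<phi> ?\<psi> = kernel_map ?\<psi>"
    by (simp_all add: fun_eq_iff comp_tuple_def subst.peval_maps)
  have forms_\<psi>\<phi>: "matrix_map ?\<phi> i \<in> forms 4 (3 * 4)" for i
    using forms_subst[OF matrix_map_forms[of i] kernel_map_forms, where 'a = real] by (simp add: subst.peval_maps)
  have forms_\<phi>\<psi>: "kernel_map ?\<psi> i \<in> forms 3 (4 * 3)" for i
    using forms_subst[OF kernel_map_forms[of i] matrix_map_forms, where 'a = real] by (simp add: subst.peval_maps)
  have "?\<phi> 4 \<notin> chordal_cubic"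
    by (rule notin_chordal_cubic[OF v]) (simp add: eval.peval_maps kernel_map_simps ker3_def v_def)
  then have "rat_map_into 4 chordal_cubic 3 {0} ?\<phi>"
    using kernel_map_forms unfolding rat_map_into_def rat_map_def coord_idx_cases
    by (auto simp: mem_chordal_cubic)
  moreover have "?\<psi> 1 \<noteq> 0"
  proof
    assume "?\<psi> 1 = 0"
    then have "eval (\<lambda>_. 1) (?\<psi> 1) = 0" by simp
    then show False by (simp add: eval.peval_maps matrix_map_def)
  qed
  then have "rat_map_into 3 {0} 4 chordal_cubic ?\<psi>"
    using matrix_map_forms unfolding rat_map_into_def rat_map_def coord_idx_cases
    by (auto elim!: dvdE simp: mem_chordal_cubic subst.peval_maps cubic_matrix_map)
  moreover have "matrix_map ?\<phi> 1 \<notin> chordal_cubic"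
    by (rule notin_chordal_cubic[OF v])
       (simp add: eval.peval_maps matrix_map_def kernel_map_def ker1_def ker2_def ker3_def v_def)
  then have "rat_map 4 chordal_cubic 4 (matrix_map ?\<phi>)"
    by (intro rat_mapI[where i = 1 and d = "3 * 4"] forms_\<psi>\<phi>) simp_all
  moreover have "same_rat_map chordal_cubic 4 (matrix_map ?\<phi>) Var"
    unfolding same_rat_map_def
  proof (intro ballI)
    fix i j assume ij: "i \<in> coord_idx 4" "j \<in> coord_idx 4"
    obtain c d where "matrix_map ?\<phi> i = scale Var * Var i + cubic Var * c"
      "matrix_map ?\<phi> j = scale Var * Var j + cubic Var * d"
      using matrix_map_kernel_map ij by metis
    \<comment> \<open>The common factor \<open>scale Var\<close> cancels in the minor, leaving only
      the multiples of the cubic.\<close>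
    then have "matrix_map ?\<phi> i * Var j - matrix_map ?\<phi> j * Var i = cubic Var * (c * Var j - d * Var i)"
      by (simp add: algebra_simps)
    \<comment> \<open>Being a form bounds the variables of the minor, the other half of membership
      in the ideal.\<close>
    moreover have "matrix_map ?\<phi> i * Var j - matrix_map ?\<phi> j * Var i \<in> forms 4 (3 * 4 + 1)"
      by (intro forms_diff forms_mult[OF forms_\<psi>\<phi> forms_Var] ij refl)
    ultimately show "matrix_map ?\<phi> i * Var j - matrix_map ?\<phi> j * Var i \<in> chordal_cubic"
      unfolding mem_chordal_cubic forms_def carrier_coord_ring by auto
  qed
  moreover have "kernel_map ?\<psi> 4 \<noteq> 0"
  proof
    assume "kernel_map ?\<psi> 4 = 0"
    \<comment> \<open>The point (0 : 0 : 0 : 1) corresponds to the diagonal matrix used above;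
      \<open>coscale\<close> is -1 there.\<close>
    then have "eval (\<lambda>i. if i = 4 then 1 else 0) (kernel_map ?\<psi> 4) = 0" by simp
    then show False by (simp add: eval.peval_maps kernel_map_def ker3_def matrix_map_def)
  qed
  then have "rat_map 3 {0} 3 (kernel_map ?\<psi>)"
    by (intro rat_mapI[where i = 4 and d = "4 * 3"] forms_\<phi>\<psi>) simp_all
  moreover have "same_rat_map {0} 3 (kernel_map ?\<psi>) Var"
    by (simp add: same_rat_map_def kernel_map_matrix_map del: One_nat_def)
  ultimately have "mutually_inverse 4 chordal_cubic 3 {0} ?\<phi> ?\<psi>"
    and "rat_map_into 4 chordal_cubic 3 {0} ?\<phi>" and "rat_map_into 3 {0} 4 chordal_cubic ?\<psi>"
    unfolding mutually_inverse_def comp_\<psi>\<phi> comp_\<phi>\<psi> by blast+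
  then show ?thesis
    unfolding rational_variety_def birational_def
    using proj_variety_chordal_cubic proj_variety_projective_space by blast
qed

end
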